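(* Let $\alpha,\beta,\gamma$ be fixed real numbers with $|\alpha|<1$, $|\beta|<1$ and $\gamma>0$. For each $n\ge 1$ let $X=X_n$ be the $n\times n$ matrix whose inverse is the tridiagonal matrix $$X^{-1}=\begin{bmatrix}\gamma & \beta\gamma & & & \\ \alpha\gamma & \gamma(1+\alpha\beta) & \beta\gamma & & \\ & \alpha\gamma & \gamma(1+\alpha\beta) & \beta\gamma & \\ & & \ddots & \ddots & \ddots \\ & & & \alpha\gamma & \gamma(1+\alpha\beta)\end{bmatrix},$$ i.e. $(X^{-1})_{1,1}=\gamma$, $(X^{-1})_{i,i}=\gamma(1+\alpha\beta)$ for $2\le i\le n$, $(X^{-1})_{i,i+1}=\beta\gamma$ and $(X^{-1})_{i+1,i}=\alpha\gamma$ for $1\le i\le n-1$, and all other entries are zero. Then there exist constants $\omega_X$ and $\omega_1>0$ independent of $n$, and a function $\omega_2(n)$ that converges geometrically fast to a constant as $n\to\infty$, such that the following hold for every $n$. (1) If $X^{(1)}$ is a best rank-1 approximation of $X$, then $$\sum_{i,j}\bigl(X_{ij}-X^{(1)}_{ij}\bigr)^2\ \ge\ \Bigl(\sum_{i,j}X_{ij}^2\Bigr)-\omega_X^2 .$$ (2) If $B$ is any reorganization of $X$ into an $n\times n$ matrix whose first column consists of the diagonal entries of $X$, and $B^{(1)}$ is a best rank-1 approximation of $B$, then $$\sum_{i,j}\bigl(B_{ij}-B^{(1)}_{ij}\bigr)^2\ \le\ \Bigl(\sum_{i,j}X_{ij}^2\Bigr)-\omega_1 n-\omega_2(n).$$ Moreover,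 the guaranteed reduction $\omega_1 n+\omega_2(n)$ in (2) increases with $n$, and for all sufficiently large $n$ the reorganized approximation dominates the original one, i.e. $\sum_{i,j}(B_{ij}-B^{(1)}_{ij})^2<\sum_{i,j}(X_{ij}-X^{(1)}_{ij})^2$.
   Context: A best rank-1 approximation of a real matrix $M$ is a matrix $Y$ of rank at most $1$ minimizing $\sum_{i,j}|M_{ij}-Y_{ij}|^2$ (squared Frobenius norm of the difference). A reorganization of $X$ is a matrix containing exactly the same multiset of entries as $X$ (each entry of $X$ is placed in exactly one position), arranged in different positions; in particular $\sum_{i,j}B_{ij}^2=\sum_{i,j}X_{ij}^2$. A function $\omega_2(n)$ converges geometrically fast to a constant $c$ if there are $K\ge 0$ and $r\in[0,1)$ with $|\omega_2(n)-c|\le K r^n$ for all $n$. Here $\omega_X$, $\omega_1$ and the function $\omega_2$ may depend on $\alpha,\beta,\gamma$. *)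

theory Defs
  imports
    Complex_Main
    "HOL-Library.Multiset"
    "Jordan_Normal_Form.DL_Rank"
    "Jordan_Normal_Form.Determinant"
begin

definition frob_sq :: "real mat \<Rightarrow> real" where
  "frob_sq M = (\<Sum>i<dim_row M. \<Sum>j<dim_col M. (M $$ (i, j))\<^sup>2)"

definition best_rank1_approx :: "real mat \<Rightarrow> real mat \<Rightarrow> bool" where
  "best_rank1_approx M Y \<longleftrightarrow>
     Y \<in> carrier_mat (dim_row M) (dim_col M) \<and>
     vec_space.rank (dim_row M) Y \<le> 1 \<and>
     (\<forall>Z \<in> carrier_mat (dim_row M) (dim_col M).
        vec_space.rank (dim_row M) Z \<le> 1 \<longrightarrow> frob_sq (M - Y) \<le> frob_sq (M - Z))"

definition entries :: "'a mat \<Rightarrow> 'a multiset" where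
  "entries M = {#M $$ p. p \<in># mset_set ({..<dim_row M} \<times> {..<dim_col M})#}"

text \<open>The rearrangement is arbitrary: individual entries may stay in place.\<close>

definition reorganization :: "'a mat \<Rightarrow> 'a mat \<Rightarrow> bool" where
  "reorganization X B \<longleftrightarrow> entries B = entries X"

text \<open>The diagonal entries may appear in the first column in any order.\<close>

definition first_col_is_diag :: "'a mat \<Rightarrow> 'a mat \<Rightarrow> bool" where
  "first_col_is_diag X B \<longleftrightarrow> mset (list_of_vec (col B 0)) = mset (diag_mat X)"

text \<open>Sequences are indexed by matrix sizes, so the value at \<open>0\<close> is irrelevant.\<close>

definition converges_geometrically :: "(nat \<Rightarrow> real) \<Rightarrow> real \<Rightarrow> bool" where
  "converges_geometrically f c \<longleftrightarrow>
     (\<exists>K r. K \<ge> 0 \<and> 0 \<le> r \<and> r < 1 \<and> (\<forall>n\<ge>1. \<bar>f n - c\<bar> \<le> K * r ^ n))"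

definition tridiag :: "real \<Rightarrow> real \<Rightarrow> real \<Rightarrow> nat \<Rightarrow> real mat" where
  "tridiag \<alpha> \<beta> \<gamma> n = mat n n (\<lambda>(i, j).
     if i = j then (if i = 0 then \<gamma> else \<gamma> * (1 + \<alpha> * \<beta>))
     else if j = i + 1 then \<beta> * \<gamma>
     else if i = j + 1 then \<alpha> * \<gamma>
     else 0)"

text \<open>The tridiagonal matrix is \<open>\<gamma>\<close> times a product of unit bidiagonal matrices, hence it has
  exactly one inverse.\<close>

lemma tridiag_inverse_unique:
  assumes "\<gamma> > 0"
  shows "\<exists>!X. X \<in> carrier_mat n n \<and> inverts_mat X (tridiag \<alpha> \<beta> \<gamma> n)
                \<and> inverts_mat (tridiag \<alpha> \<beta> \<gamma> n) X"
proof -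
  let ?T = "tridiag \<alpha> \<beta> \<gamma> n"
  define L :: "real mat" where
    "L = mat n n (\<lambda>(i, j). if i = j then 1 else if i = j + 1 then \<alpha> else 0)"
  define U :: "real mat" where
    "U = mat n n (\<lambda>(i, j). if i = j then 1 else if j = i + 1 then \<beta> else 0)"
  have L: "L \<in> carrier_mat n n" and U: "U \<in> carrier_mat n n" by (auto simp: L_def U_def)
  have T: "?T \<in> carrier_mat n n" by (simp add: tridiag_def)
  have factored: "?T = \<gamma> \<cdot>\<^sub>m (L * U)"
  proof (rule eq_matI)
    fix i j assume "i < dim_row (\<gamma> \<cdot>\<^sub>m (L * U))" "j < dim_col (\<gamma> \<cdot>\<^sub>m (L * U))"
    then have ij: "i < n" "j < n" using L U by auto
    have "(L * U) $$ (i, j) = (\<Sum>k = 0..<n. L $$ (i, k) * U $$ (k, j))"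
      using ij L U by (auto simp: scalar_prod_def intro!: sum.cong)
    also have "\<dots> = (\<Sum>k = 0..<n. (if k = i then U $$ (i, j) else 0)
                       + (if Suc k = i then \<alpha> * U $$ (k, j) else 0))"
      using ij by (intro sum.cong) (auto simp: L_def)
    also have "\<dots> = U $$ (i, j) + (if i = 0 then 0 else \<alpha> * U $$ (i - 1, j))"
    proof (cases i)
      case 0
      then show ?thesis using ij by (simp add: sum.distrib)
    next
      case (Suc m)
      then show ?thesis using ij by (simp add: sum.distrib)
    qed
    finally have "(L * U) $$ (i, j) = U $$ (i, j) + (if i = 0 then 0 else \<alpha> * U $$ (i - 1, j))" .
    then show "?T $$ (i, j) = (\<gamma> \<cdot>\<^sub>m (L * U)) $$ (i, j)"
      using ij L U by (cases i) (auto simp: tridiag_def U_def distrib_left)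
  qed (use L U in \<open>auto simp: tridiag_def\<close>)
  have "det L = 1"
    using det_lower_triangular[OF _ L] by (auto simp: L_def prod_list_diag_prod)
  moreover have "det U = 1"
    by (subst det_upper_triangular[OF _ U]) (auto simp: U_def prod_list_diag_prod)
  ultimately have "det ?T \<noteq> 0"
    using assms L U by (simp add: factored det_mult[OF L U])
  then have "?T \<in> Units (ring_mat TYPE(real) n ())"
    by (rule det_non_zero_imp_unit[OF T])
  then obtain X where X: "X \<in> carrier_mat n n" "X * ?T = 1\<^sub>m n" "?T * X = 1\<^sub>m n"
    by (auto simp: Units_def ring_mat_simps)
  show ?thesis
  proof (rule ex1I[of _ X])
    show "X \<in> carrier_mat n n \<and> inverts_mat X ?T \<and> inverts_mat ?T X"
      using X T by (auto simp: inverts_mat_def)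
  next
    fix Y assume Y: "Y \<in> carrier_mat n n \<and> inverts_mat Y ?T \<and> inverts_mat ?T Y"
    then have YC: "Y \<in> carrier_mat n n" and YT: "Y * ?T = 1\<^sub>m n"
      by (auto simp: inverts_mat_def)
    have "Y = Y * (?T * X)" using X YC by simp
    also have "\<dots> = (Y * ?T) * X" using YC T X by (simp add: assoc_mult_mat[OF YC T X(1)])
    also have "\<dots> = X" using YT X by simp
    finally show "Y = X" .
  qed
qed

end

theory Submission
  imports Defs
begin

text \<open>The tridiagonal matrix is \<open>\<gamma> L U\<close> with \<open>L\<close>, \<open>U\<close> unit bidiagonal, and
  \<open>\<parallel>L x\<parallel> \<ge> (1 - \<bar>\<alpha>\<bar>) \<parallel>x\<parallel>\<close>, \<open>\<parallel>U x\<parallel> \<ge> (1 - \<bar>\<beta>\<bar>) \<parallel>x\<parallel>\<close>. So the operator norm of \<open>X\<close> is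
  bounded independently of \<open>n\<close>, and a rank-1 approximation gains at most its square. The
  diagonal entries of \<open>X\<close> are \<open>(1 - (\<alpha>\<beta>)\<^sup>k) / (\<gamma> (1 - \<alpha>\<beta>))\<close> for \<open>1 \<le> k \<le> n\<close>, so keeping only the first
  column of \<open>B\<close>, a matrix of rank at most 1, already gains an amount that grows linearly.\<close>

section \<open>Matrices of rank at most 1 as outer products\<close>

text \<open>Two distinct independent columns would force rank 2, so once a nonzero column is fixed,
  every other column is a multiple of it.\<close>

lemma (in vec_space) rank_le_1_imp_product_entries:
  assumes A: "A \<in> carrier_mat n nc" and rank: "rank A \<le> 1"
  obtains f g where "\<And>i j. i < n \<Longrightarrow> j < nc \<Longrightarrow> A $$ (i, j) = f i * g j"
proof (cases "\<exists>c<nc. col A c \<noteq> 0\<^sub>v n")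
  case False
  then have "A $$ (i, j) = 0 * 0" if "i < n" "j < nc" for i j
    using that A by (metis carrier_matD index_col index_zero_vec(1) mult_zero_left)
  then show ?thesis by (rule that)
next
  case True
  then obtain c where c: "c < nc" "col A c \<noteq> 0\<^sub>v n" by blast
  let ?x = "col A c"
  have x: "?x \<in> carrier_vec n" using A by (simp add: col_def)
  have "\<exists>b. \<forall>i<n. A $$ (i, j) = ?x $ i * b" if j: "j < nc" for j
  \<comment> \<open>Equal columns are split off because \<open>{?x, ?y}\<close> would then be a
    singleton, and the rank bound says nothing about its dependence.\<close>
  proof (cases "col A j = ?x")
    case True
    then have "\<forall>i<n. A $$ (i, j) = ?x $ i * 1"
      using A j by (metis carrier_matD index_col mult_1_right)
    then show ?thesis by blast
  next
    case False
    let ?y = "col A j"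
    have y: "?y \<in> carrier_vec n" using A by (simp add: col_def)
    have sub: "{?x, ?y} \<subseteq> set (cols A)"
      using A c j by (auto simp: cols_def)
    have "lin_dep {?x, ?y}"
    proof (rule ccontr)
      assume "\<not> lin_dep {?x, ?y}"
      from rank_ge_card_indpt[OF A sub this] False rank show False by simp
    qed
    then obtain a w where a: "lincomb a {?x, ?y} = 0\<^sub>v n" "w \<in> {?x, ?y}" "a w \<noteq> 0"
      using finite_lin_dep[of "{?x, ?y}"] x y by auto
    have eq: "a ?x * ?x $ i + a ?y * ?y $ i = 0" if "i < n" for i
    proof -
      have "lincomb a {?x, ?y} $ i = 0" using a(1) that by simp
      then show ?thesis using lincomb_index[OF that, of "{?x, ?y}" a] x y False by simp
    qed
    \<comment> \<open>Otherwise the relation would involve only \<open>?x\<close>, which is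
      nonzero.\<close>
    have "a ?y \<noteq> 0"
    proof
      assume 0: "a ?y = 0"
      with a have "a ?x \<noteq> 0" by auto
      with eq 0 have "?x = 0\<^sub>v n" using x A by (intro eq_vecI) auto
      with c show False by simp
    qed
    then have "\<forall>i<n. A $$ (i, j) = ?x $ i * (- a ?x / a ?y)"
      using eq A j by (auto simp: field_simps eq_neg_iff_add_eq_0)
    then show ?thesis by blast
  qed
  then have "\<forall>j\<in>{..<nc}. \<exists>b. \<forall>i<n. A $$ (i, j) = ?x $ i * b" by blast
  from bchoice[OF this] obtain g where "\<forall>j<nc. \<forall>i<n. A $$ (i, j) = ?x $ i * g j" by auto
  then show ?thesis by (intro that[of "\<lambda>i. ?x $ i" g]) auto
qed

section \<open>Frobenius errors of rank-1 approximations\<close>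

lemma frob_sq_eq_sum_mset: "frob_sq M = (\<Sum>x\<in>#entries M. x\<^sup>2)"
  unfolding frob_sq_def entries_def sum.cartesian_product
  by (simp add: sum_unfold_sum_mset image_mset.compositionality comp_def case_prod_beta)

lemma frob_sq_reorganization: "reorganization X B \<Longrightarrow> frob_sq B = frob_sq X"
  by (simp add: reorganization_def frob_sq_eq_sum_mset)

lemma sum_sq_first_col:
  fixes X B :: "real mat"
  assumes "X \<in> carrier_mat n n" "B \<in> carrier_mat n n" "first_col_is_diag X B"
  shows "(\<Sum>i<n. (B $$ (i, 0))\<^sup>2) = (\<Sum>i<n. (X $$ (i, i))\<^sup>2)"
proof (cases "n = 0")
  case False
  have "(\<Sum>x\<in>#mset (list_of_vec (col B 0)). x\<^sup>2) = (\<Sum>x\<in>#mset (diag_mat X). x\<^sup>2)"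
    using assms by (simp add: first_col_is_diag_def)
  moreover have "list_of_vec (col B 0) = map (\<lambda>i. B $$ (i, 0)) [0..<n]"
    using assms False by (intro nth_equalityI) (auto simp: list_of_vec_index)
  ultimately show ?thesis
    using assms
    by (simp add: diag_mat_def sum_mset_sum_list comp_def interv_sum_list_conv_sum_set_nat
        atLeast0LessThan flip: mset_map)
qed simp

text \<open>The competitor \<open>Z\<close> keeps the first column of \<open>B\<close> and is zero
  elsewhere. It is an outer product, so its error bounds the optimal one.\<close>

lemma frob_sq_minus_first_col:
  assumes B: "B \<in> carrier_mat n n" and Y: "best_rank1_approx B Y"
  shows "frob_sq (B - Y) \<le> frob_sq B - (\<Sum>i<n. (B $$ (i, 0))\<^sup>2)"
proof (cases "n = 0")
  case True
  with B Y show ?thesis by (auto simp: frob_sq_def best_rank1_approx_def)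
next
  case False
  interpret vec_space "TYPE(real)" n .
  define Z where "Z = mat n n (\<lambda>(i, j). B $$ (i, 0) * (if j = 0 then 1 else 0))"
  have Z: "Z \<in> carrier_mat n n" by (simp add: Z_def)
  have "rank Z \<le> 1"
    by (rule rank_le_1_product_entries[OF Z, of "\<lambda>i. B $$ (i, 0)" "\<lambda>j. if j = 0 then 1 else 0"])
      (auto simp: Z_def)
  then have "frob_sq (B - Y) \<le> frob_sq (B - Z)"
    using Y B Z by (auto simp: best_rank1_approx_def)
  also have "\<dots> = (\<Sum>i<n. \<Sum>j<n. (B $$ (i, j))\<^sup>2 - (if j = 0 then (B $$ (i, 0))\<^sup>2 else 0))"
    using B by (auto simp: frob_sq_def Z_def intro!: sum.cong)
  also have "\<dots> = frob_sq B - (\<Sum>i<n. (B $$ (i, 0))\<^sup>2)"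
    using B False by (simp add: frob_sq_def sum_subtractf)
  finally show ?thesis .
qed

text \<open>For \<open>Y = u v\<^sup>T\<close> and \<open>w = X v\<close>, expand \<open>0 \<le> \<Sum>i. (w i - \<parallel>v\<parallel>\<^sup>2 u i)\<^sup>2\<close> and divide by \<open>\<parallel>v\<parallel>\<^sup>2\<close>.\<close>

lemma frob_sq_minus_rank_le_1:
  assumes X: "X \<in> carrier_mat n n" and Y: "Y \<in> carrier_mat n n" "vec_space.rank n Y \<le> 1"
    and norm: "\<And>v. (\<Sum>i<n. (\<Sum>j<n. X $$ (i, j) * v j)\<^sup>2) \<le> s\<^sup>2 * (\<Sum>j<n. (v j)\<^sup>2)"
  shows "frob_sq (X - Y) \<ge> frob_sq X - s\<^sup>2"
proof -
  interpret vec_space "TYPE(real)" n .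
  obtain u v where uv: "\<And>i j. i < n \<Longrightarrow> j < n \<Longrightarrow> Y $$ (i, j) = u i * v j"
    using rank_le_1_imp_product_entries[OF Y] by blast
  define w where "w i = (\<Sum>j<n. X $$ (i, j) * v j)" for i
  define V where "V = (\<Sum>j<n. (v j)\<^sup>2)"
  \<comment> \<open>The change in squared error when \<open>u v^T\<close> is subtracted: its own
    squared norm minus twice its inner product with \<open>X\<close>.\<close>
  define E where "E = (\<Sum>i<n. V * (u i)\<^sup>2 - 2 * u i * w i)"
  have "frob_sq (X - Y) = (\<Sum>i<n. \<Sum>j<n. (X $$ (i, j) - u i * v j)\<^sup>2)"
    using X Y uv by (auto simp: frob_sq_def intro!: sum.cong)
  also have "\<dots> = (\<Sum>i<n. (\<Sum>j<n. (X $$ (i, j))\<^sup>2) + (V * (u i)\<^sup>2 - 2 * u i * w i))"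
    by (simp add: power2_diff power_mult_distrib sum.distrib sum_subtractf V_def w_def
        sum_distrib_left sum_distrib_right mult_ac)
  also have "\<dots> = frob_sq X + E"
    using X by (simp add: sum.distrib frob_sq_def E_def)
  finally have frob: "frob_sq (X - Y) = frob_sq X + E" .
  have V: "V \<ge> 0" by (simp add: V_def sum_nonneg)
  have W: "(\<Sum>i<n. (w i)\<^sup>2) \<le> s\<^sup>2 * V" using norm[of v] by (simp add: w_def V_def)
  have "0 \<le> (\<Sum>i<n. (w i - V * u i)\<^sup>2)" by (simp add: sum_nonneg)
  also have "\<dots> = (\<Sum>i<n. (w i)\<^sup>2) + V * E"
    unfolding E_def sum_distrib_left sum.distrib[symmetric]
    by (intro sum.cong) (auto simp: power2_eq_square algebra_simps)
  finally have "0 \<le> V * (s\<^sup>2 + E)" using W by (simp add: algebra_simps)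
  \<comment> \<open>Division by \<open>V\<close> fails here, but the norm bound then forces
    \<open>w = 0\<close>.\<close>
  moreover have "E = 0" if "V = 0"
  proof -
    from that W have "(\<Sum>i<n. (w i)\<^sup>2) = 0" by (simp add: antisym sum_nonneg)
    with that show ?thesis by (simp add: E_def sum_nonneg_eq_0_iff)
  qed
  ultimately have "0 \<le> s\<^sup>2 + E"
    using V by (cases "V = 0") (auto simp: zero_le_mult_iff)
  with frob show ?thesis by simp
qed

section \<open>Operator norm of the inverse\<close>

text \<open>The factorization \<open>\<gamma> L U\<close> applied to a vector: \<open>z\<close> is
  \<open>U x\<close>, and the right-hand side is a row of \<open>\<gamma> L z\<close>. The
  convention \<open>x n = 0\<close> accounts for the superdiagonal entry missing from the last
  row.\<close>

lemma tridiag_mult_sum: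
  fixes x :: "nat \<Rightarrow> real" and \<beta> :: real
  assumes "i < n" and "x n = 0"
  defines "z \<equiv> \<lambda>k. x k + \<beta> * x (Suc k)"
  shows "(\<Sum>k<n. tridiag \<alpha> \<beta> \<gamma> n $$ (i, k) * x k)
    = \<gamma> * (z i + \<alpha> * (if i = 0 then 0 else z (i - 1)))"
proof -
  have "(\<Sum>k<n. tridiag \<alpha> \<beta> \<gamma> n $$ (i, k) * x k) =
    (\<Sum>k<n. (if k = i then (if i = 0 then \<gamma> else \<gamma> * (1 + \<alpha> * \<beta>)) * x i else 0)
      + (if k = Suc i then \<beta> * \<gamma> * x (Suc i) else 0)
      + (if i \<noteq> 0 \<and> k = i - 1 then \<alpha> * \<gamma> * x (i - 1) else 0))"
    using assms by (intro sum.cong) (auto simp: tridiag_def)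
  also have "\<dots> = (if i = 0 then \<gamma> else \<gamma> * (1 + \<alpha> * \<beta>)) * x i + \<beta> * \<gamma> * x (Suc i)
      + (if i = 0 then 0 else \<alpha> * \<gamma> * x (i - 1))"
  proof -
    have "(\<Sum>k<n. if k = Suc i then \<beta> * \<gamma> * x (Suc i) else 0) = \<beta> * \<gamma> * x (Suc i)"
      using assms(1,2) by (cases "Suc i = n") auto
    then show ?thesis using assms(1) by (cases i) (simp_all add: sum.distrib)
  qed
  also have "\<dots> = \<gamma> * (z i + \<alpha> * (if i = 0 then 0 else z (i - 1)))"
    by (cases i) (auto simp: z_def algebra_simps)
  finally show ?thesis .
qed

text \<open>A reverse triangle inequality in squared form. Square roots are avoided by using
  \<open>2 \<bar>x y\<bar> \<le> x\<^sup>2 + y\<^sup>2\<close> termwise; the comparison of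
  \<open>y\<close> with \<open>x\<close> enters only after summation.\<close>

lemma sum_sq_perturb_ge:
  fixes x y :: "'a \<Rightarrow> real"
  assumes c: "\<bar>c\<bar> \<le> 1" and le: "(\<Sum>i\<in>A. (y i)\<^sup>2) \<le> (\<Sum>i\<in>A. (x i)\<^sup>2)"
  shows "(1 - \<bar>c\<bar>)\<^sup>2 * (\<Sum>i\<in>A. (x i)\<^sup>2) \<le> (\<Sum>i\<in>A. (x i + c * y i)\<^sup>2)"
proof -
  have pt: "(1 - \<bar>c\<bar>) * ((x i)\<^sup>2 - \<bar>c\<bar> * (y i)\<^sup>2) \<le> (x i + c * y i)\<^sup>2" for i
  proof -
    have "0 \<le> \<bar>c\<bar> * (\<bar>x i\<bar> - \<bar>y i\<bar>)\<^sup>2" by simp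
    then have "- \<bar>c\<bar> * ((x i)\<^sup>2 + (y i)\<^sup>2) \<le> - 2 * \<bar>c * x i * y i\<bar>"
      by (simp add: power2_diff abs_mult algebra_simps)
    also have "\<dots> \<le> 2 * (c * x i * y i)" by linarith
    finally show ?thesis by (simp add: power2_eq_square algebra_simps abs_mult_self_eq)
  qed
  have "(1 - \<bar>c\<bar>)\<^sup>2 * (\<Sum>i\<in>A. (x i)\<^sup>2)
      \<le> (1 - \<bar>c\<bar>) * ((\<Sum>i\<in>A. (x i)\<^sup>2) - \<bar>c\<bar> * (\<Sum>i\<in>A. (y i)\<^sup>2))"
    using c mult_left_mono[OF le, of "\<bar>c\<bar>"]
    by (simp add: power2_eq_square mult.assoc) (intro mult_left_mono; simp add: algebra_simps)
  also have "\<dots> = (\<Sum>i\<in>A. (1 - \<bar>c\<bar>) * ((x i)\<^sup>2 - \<bar>c\<bar> * (y i)\<^sup>2))"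
    by (simp add: sum_subtractf flip: sum_distrib_left)
  also have "\<dots> \<le> (\<Sum>i\<in>A. (x i + c * y i)\<^sup>2)"
    by (intro sum_mono pt)
  finally show ?thesis .
qed

text \<open>Both bidiagonal factors are the identity plus a multiple of a shift, and shifts do not
  increase the norm, so the perturbation bound applies twice.\<close>

lemma tridiag_norm_ge:
  fixes x :: "nat \<Rightarrow> real"
  assumes "\<bar>\<alpha>\<bar> \<le> 1" "\<bar>\<beta>\<bar> \<le> 1"
  shows "(\<gamma> * (1 - \<bar>\<alpha>\<bar>) * (1 - \<bar>\<beta>\<bar>))\<^sup>2 * (\<Sum>i<n. (x i)\<^sup>2)
    \<le> (\<Sum>i<n. (\<Sum>k<n. tridiag \<alpha> \<beta> \<gamma> n $$ (i, k) * x k)\<^sup>2)"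
proof -
  \<comment> \<open>Truncation supplies the boundary value 0 at index \<open>n\<close>.\<close>
  define x' where "x' k = (if k < n then x k else 0)" for k
  define z where "z k = x' k + \<beta> * x' (Suc k)" for k
  have x'0: "x' n = 0" by (simp add: x'_def)
  have "(\<Sum>i<n. (x' (Suc i))\<^sup>2) \<le> (\<Sum>i<n. (x' i)\<^sup>2)"
    using sum.lessThan_Suc_shift[of "\<lambda>i. (x' i)\<^sup>2" n] x'0 by simp
  then have 1: "(1 - \<bar>\<beta>\<bar>)\<^sup>2 * (\<Sum>i<n. (x' i)\<^sup>2) \<le> (\<Sum>i<n. (z i)\<^sup>2)"
    unfolding z_def by (rule sum_sq_perturb_ge[OF assms(2)])
  have "(\<Sum>i<n. (if i = 0 then 0 else z (i - 1))\<^sup>2) \<le> (\<Sum>i<n. (z i)\<^sup>2)"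
  proof (cases n)
    case (Suc m)
    have "(\<Sum>i<n. (if i = 0 then 0 else z (i - 1))\<^sup>2) = (\<Sum>i<m. (z i)\<^sup>2)"
      unfolding Suc sum.lessThan_Suc_shift by simp
    then show ?thesis by (simp add: Suc)
  qed simp
  then have 2: "(1 - \<bar>\<alpha>\<bar>)\<^sup>2 * (\<Sum>i<n. (z i)\<^sup>2)
      \<le> (\<Sum>i<n. (z i + \<alpha> * (if i = 0 then 0 else z (i - 1)))\<^sup>2)"
    by (rule sum_sq_perturb_ge[OF assms(1)])
  have T: "(\<Sum>k<n. tridiag \<alpha> \<beta> \<gamma> n $$ (i, k) * x k)
      = \<gamma> * (z i + \<alpha> * (if i = 0 then 0 else z (i - 1)))" if "i < n" for i
    using tridiag_mult_sum[of i n x' \<alpha> \<beta> \<gamma>, OF that x'0] by (simp add: x'_def z_def)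
  have "(\<gamma> * (1 - \<bar>\<alpha>\<bar>) * (1 - \<bar>\<beta>\<bar>))\<^sup>2 * (\<Sum>i<n. (x i)\<^sup>2)
      = \<gamma>\<^sup>2 * ((1 - \<bar>\<alpha>\<bar>)\<^sup>2 * ((1 - \<bar>\<beta>\<bar>)\<^sup>2 * (\<Sum>i<n. (x' i)\<^sup>2)))"
    by (simp add: x'_def power_mult_distrib mult_ac)
  also have "\<dots> \<le> \<gamma>\<^sup>2 * ((1 - \<bar>\<alpha>\<bar>)\<^sup>2 * (\<Sum>i<n. (z i)\<^sup>2))"
    by (intro mult_left_mono 1) auto
  also have "\<dots> \<le> \<gamma>\<^sup>2 * (\<Sum>i<n. (z i + \<alpha> * (if i = 0 then 0 else z (i - 1)))\<^sup>2)"
    by (intro mult_left_mono 2) auto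
  also have "\<dots> = (\<Sum>i<n. (\<Sum>k<n. tridiag \<alpha> \<beta> \<gamma> n $$ (i, k) * x k)\<^sup>2)"
    by (simp add: T sum_distrib_left power_mult_distrib)
  finally show ?thesis .
qed

lemma inverts_mat_sum:
  assumes "A \<in> carrier_mat n n" "B \<in> carrier_mat n n" "inverts_mat A B" "i < n" "j < n"
  shows "(\<Sum>k<n. A $$ (i, k) * B $$ (k, j)) = (if i = j then 1 else 0)"
proof -
  have "(A * B) $$ (i, j) = (if i = j then 1 else 0)"
    using assms by (simp add: inverts_mat_def)
  then show ?thesis using assms by (simp add: scalar_prod_def atLeast0LessThan)
qed

text \<open>The lower bound for the tridiagonal matrix is applied to the vector \<open>X v\<close>,
  which that matrix maps to \<open>v\<close>.\<close>

lemma tridiag_inverse_norm_le: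
  assumes ab: "\<bar>\<alpha>\<bar> < 1" "\<bar>\<beta>\<bar> < 1" "\<gamma> > 0"
    and X: "X \<in> carrier_mat n n" "inverts_mat (tridiag \<alpha> \<beta> \<gamma> n) X"
  shows "(\<Sum>i<n. (\<Sum>j<n. X $$ (i, j) * v j)\<^sup>2)
    \<le> (1 / (\<gamma> * (1 - \<bar>\<alpha>\<bar>) * (1 - \<bar>\<beta>\<bar>)))\<^sup>2 * (\<Sum>j<n. (v j)\<^sup>2)"
proof -
  let ?T = "tridiag \<alpha> \<beta> \<gamma> n"
  let ?s = "\<gamma> * (1 - \<bar>\<alpha>\<bar>) * (1 - \<bar>\<beta>\<bar>)"
  have s: "?s > 0" using ab by simp
  have T: "?T \<in> carrier_mat n n" by (simp add: tridiag_def)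
  have "(\<Sum>k<n. ?T $$ (i, k) * (\<Sum>j<n. X $$ (k, j) * v j)) = v i" if "i < n" for i
  proof -
    have "(\<Sum>k<n. ?T $$ (i, k) * (\<Sum>j<n. X $$ (k, j) * v j))
        = (\<Sum>j<n. (\<Sum>k<n. ?T $$ (i, k) * X $$ (k, j)) * v j)"
      unfolding sum_distrib_left sum_distrib_right
      by (subst sum.swap) (simp add: mult.assoc)
    also have "\<dots> = (\<Sum>j<n. if i = j then v j else 0)"
      using inverts_mat_sum[OF T X that] by (intro sum.cong) auto
    finally show ?thesis using that by simp
  qed
  then have "?s\<^sup>2 * (\<Sum>i<n. (\<Sum>j<n. X $$ (i, j) * v j)\<^sup>2) \<le> (\<Sum>i<n. (v i)\<^sup>2)"
    using tridiag_norm_ge[of \<alpha> \<beta> \<gamma> "\<lambda>i. \<Sum>j<n. X $$ (i, j) * v j" n] ab by simp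
  then show ?thesis using s by (simp add: power_divide field_simps)
qed

section \<open>Diagonal entries of the inverse\<close>

text \<open>Column \<open>j\<close> of the inverse solves two bidiagonal systems: forward substitution gives
  \<open>z\<close>, and back substitution then gives the column itself.\<close>

lemma tridiag_inverse_diag:
  assumes "\<gamma> > 0"
    and X: "X \<in> carrier_mat n n" "inverts_mat (tridiag \<alpha> \<beta> \<gamma> n) X" and j: "j < n"
  shows "X $$ (j, j) = (\<Sum>m<n - j. (\<alpha> * \<beta>) ^ m) / \<gamma>"
proof -
  define x where "x k = (if k < n then X $$ (k, j) else 0)" for k
  define z where "z k = x k + \<beta> * x (Suc k)" for k
  have xn: "x n = 0" by (simp add: x_def)
  have T: "tridiag \<alpha> \<beta> \<gamma> n \<in> carrier_mat n n" by (simp add: tridiag_def)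
  have rec: "z i + \<alpha> * (if i = 0 then 0 else z (i - 1)) = (if i = j then 1 / \<gamma> else 0)"
    if "i < n" for i
  proof -
    have "\<gamma> * (z i + \<alpha> * (if i = 0 then 0 else z (i - 1))) = (if i = j then 1 else 0)"
      using tridiag_mult_sum[of i n x \<alpha> \<beta> \<gamma>, OF that xn] inverts_mat_sum[OF T X that j]
      by (simp add: x_def z_def)
    then have "z i + \<alpha> * (if i = 0 then 0 else z (i - 1)) = (if i = j then 1 else 0) / \<gamma>"
      using assms(1) by (simp add: eq_divide_eq mult.commute)
    then show ?thesis by simp
  qed
  have z0: "z i = 0" if "i < j" for i
    using that
  proof (induction i)
    case 0
    then show ?case using rec[of 0] j by simp
  next
    case (Suc i)
    then show ?case using rec[of "Suc i"] j by simp
  qed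
  have z1: "j + d < n \<Longrightarrow> z (j + d) = (- \<alpha>) ^ d / \<gamma>" for d
  proof (induction d)
    case 0
    then show ?case using rec[of j] z0[of "j - 1"] by (cases j) auto
  next
    case (Suc d)
    then show ?case using rec[of "Suc (j + d)"] by (simp add: field_simps)
  qed
  \<comment> \<open>Back substitution runs upwards from the boundary value \<open>x n = 0\<close>
    and stops at row \<open>j\<close>, where the power of \<open>- \<alpha>\<close> is 1.\<close>
  have "d \<le> n - j \<Longrightarrow> x (n - d) = (- \<alpha>) ^ (n - d - j) * (\<Sum>m<d. (\<alpha> * \<beta>) ^ m) / \<gamma>" for d
  proof (induction d)
    case 0
    then show ?case by (simp add: xn)
  next
    case (Suc d)
    have e: "n - d - j = Suc (n - Suc d - j)" "Suc (n - Suc d) = n - d"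
      "n - Suc d = j + (n - Suc d - j)" using Suc.prems j by auto
    have "x (n - Suc d) = z (n - Suc d) - \<beta> * x (n - d)"
      using e(2) by (simp add: z_def)
    also have "z (n - Suc d) = (- \<alpha>) ^ (n - Suc d - j) / \<gamma>"
      using z1[of "n - Suc d - j"] e(3) Suc.prems j by simp
    also have "x (n - d) = (- \<alpha>) ^ Suc (n - Suc d - j) * (\<Sum>m<d. (\<alpha> * \<beta>) ^ m) / \<gamma>"
      using Suc e(1) by simp
    \<comment> \<open>With \<open>q = \<alpha> * \<beta>\<close>, this is the recursion that one
      plus \<open>q\<close> times a geometric sum is the next geometric sum.\<close>
    finally show ?case
      unfolding sum.lessThan_Suc_shift
      by (simp add: algebra_simps add_divide_distrib flip: sum_distrib_left)
  qed
  from this[of "n - j"] j show ?thesis by (simp add: x_def)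
qed

text \<open>Entry \<open>i\<close> depends on \<open>n - i\<close> only. Reversing the order makes
  the summands independent of \<open>n\<close>, so sums for different sizes become
  comparable.\<close>

lemma sum_sq_diag_tridiag_inverse:
  assumes "\<bar>\<alpha>\<bar> < 1" "\<bar>\<beta>\<bar> < 1" "\<gamma> > 0"
    and X: "X \<in> carrier_mat n n" "inverts_mat (tridiag \<alpha> \<beta> \<gamma> n) X"
  shows "(\<Sum>i<n. (X $$ (i, i))\<^sup>2)
    = (\<Sum>k<n. (1 - (\<alpha> * \<beta>) ^ Suc k)\<^sup>2) / (\<gamma> * (1 - \<alpha> * \<beta>))\<^sup>2"
proof -
  have q: "\<bar>\<alpha> * \<beta>\<bar> < 1"
    using assms mult_strict_mono'[of "\<bar>\<alpha>\<bar>" 1 "\<bar>\<beta>\<bar>" 1] by (simp add: abs_mult)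
  have "X $$ (i, i) = (1 - (\<alpha> * \<beta>) ^ (n - i)) / (\<gamma> * (1 - \<alpha> * \<beta>))" if "i < n" for i
    unfolding tridiag_inverse_diag[OF assms(3) X that]
    using q by (subst sum_gp_strict) (auto simp: mult.commute)
  then have "(\<Sum>i<n. (X $$ (i, i))\<^sup>2)
      = (\<Sum>i<n. (1 - (\<alpha> * \<beta>) ^ (n - i))\<^sup>2 / (\<gamma> * (1 - \<alpha> * \<beta>))\<^sup>2)"
    by (intro sum.cong) (auto simp: power_divide)
  also have "\<dots> = (\<Sum>k<n. (1 - (\<alpha> * \<beta>) ^ Suc k)\<^sup>2 / (\<gamma> * (1 - \<alpha> * \<beta>))\<^sup>2)"
    by (subst sum.nat_diff_reindex[symmetric]) (auto intro!: sum.cong simp: Suc_diff_Suc)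
  finally show ?thesis by (simp add: sum_divide_distrib)
qed

section \<open>Geometric convergence of the remainder\<close>

text \<open>The tail is \<open>r ^ Suc n / (1 - r)\<close>, and
  \<open>\<bar>1 - r\<bar> \<ge> 1 - \<bar>r\<bar>\<close>.\<close>

lemma sum_power_Suc_geometric:
  fixes r :: real
  assumes "\<bar>r\<bar> < 1"
  shows "\<bar>(\<Sum>k<n. r ^ Suc k) - r / (1 - r)\<bar> \<le> \<bar>r\<bar> ^ n / (1 - \<bar>r\<bar>)"
proof -
  have "(\<Sum>k<n. r ^ Suc k) = r * (1 - r ^ n) / (1 - r)"
    using assms by (simp add: sum_gp_strict flip: sum_distrib_left)
  then have "\<bar>(\<Sum>k<n. r ^ Suc k) - r / (1 - r)\<bar> = \<bar>r\<bar> * \<bar>r\<bar> ^ n / \<bar>1 - r\<bar>"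
    by (simp add: abs_mult power_abs algebra_simps flip: diff_divide_distrib)
  also have "\<dots> \<le> 1 * \<bar>r\<bar> ^ n / (1 - \<bar>r\<bar>)"
    using assms by (intro frac_le mult_right_mono) auto
  finally show ?thesis by simp
qed

text \<open>Expanding the squares, the ones cancel \<open>real n\<close>, leaving geometric sums
  with ratios \<open>q\<^sup>2\<close> and \<open>q\<close>.\<close>

lemma converges_geometrically_sum_sq:
  fixes q a :: real
  assumes q: "\<bar>q\<bar> < 1" and a: "a \<ge> 0"
  shows "\<exists>c. converges_geometrically (\<lambda>n. a * ((\<Sum>k<n. (1 - q ^ Suc k)\<^sup>2) - real n)) c"
proof -
  have q2: "\<bar>q\<^sup>2\<bar> < 1" using q by (simp add: power_less_one_iff abs_square_less_1)
  \<comment> \<open>This lets both tails decay at the common rate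
    \<open>\<bar>q\<bar>\<close>.\<close>
  have q2le: "q\<^sup>2 \<le> \<bar>q\<bar>"
    using q mult_left_mono[of "\<bar>q\<bar>" 1 "\<bar>q\<bar>"] by (simp add: power2_eq_square)
  define c where "c = q\<^sup>2 / (1 - q\<^sup>2) - 2 * (q / (1 - q))"
  define K where "K = 1 / (1 - q\<^sup>2) + 2 * (1 / (1 - \<bar>q\<bar>))"
  have K: "K \<ge> 0" using q q2 by (simp add: K_def)
  have "\<bar>a * ((\<Sum>k<n. (1 - q ^ Suc k)\<^sup>2) - real n) - a * c\<bar> \<le> (a * K) * \<bar>q\<bar> ^ n" for n
  proof -
    have "(\<Sum>k<n. (1 - q ^ Suc k)\<^sup>2) - real n
        = (\<Sum>k<n. (q\<^sup>2) ^ Suc k) - 2 * (\<Sum>k<n. q ^ Suc k)"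
      by (simp add: power2_diff sum.distrib sum_subtractf sum_distrib_left mult_ac
          power_mult_distrib flip: power_mult)
    then have "\<bar>(\<Sum>k<n. (1 - q ^ Suc k)\<^sup>2) - real n - c\<bar>
        \<le> (q\<^sup>2) ^ n / (1 - q\<^sup>2) + 2 * (\<bar>q\<bar> ^ n / (1 - \<bar>q\<bar>))"
      using sum_power_Suc_geometric[OF q2, of n] sum_power_Suc_geometric[OF q, of n]
      unfolding c_def abs_le_iff by (simp only: abs_power2) linarith
    also have "\<dots> \<le> \<bar>q\<bar> ^ n / (1 - q\<^sup>2) + 2 * (\<bar>q\<bar> ^ n / (1 - \<bar>q\<bar>))"
      using q2 q2le by (intro add_right_mono divide_right_mono power_mono) auto
    also have "\<dots> = K * \<bar>q\<bar> ^ n" by (simp add: K_def algebra_simps)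
    finally have "a * \<bar>(\<Sum>k<n. (1 - q ^ Suc k)\<^sup>2) - real n - c\<bar> \<le> a * (K * \<bar>q\<bar> ^ n)"
      using a by (rule mult_left_mono)
    then show ?thesis using a by (simp add: abs_mult mult.assoc flip: right_diff_distrib)
  qed
  then show ?thesis
    unfolding converges_geometrically_def using a K q
    by (intro exI[of _ "a * c"] exI[of _ "a * K"] exI[of _ "\<bar>q\<bar>"]) auto
qed

section \<open>Choice of the constants and comparison for large sizes\<close>

theorem theorem1:
  fixes \<alpha> \<beta> \<gamma> :: real and X :: "nat \<Rightarrow> real mat"
  assumes "\<bar>\<alpha>\<bar> < 1" and "\<bar>\<beta>\<bar> < 1" and "\<gamma> > 0"
    and "\<And>n. n \<ge> 1 \<Longrightarrow> X n \<in> carrier_mat n n"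
    and "\<And>n. n \<ge> 1 \<Longrightarrow> inverts_mat (X n) (tridiag \<alpha> \<beta> \<gamma> n)"
    and "\<And>n. n \<ge> 1 \<Longrightarrow> inverts_mat (tridiag \<alpha> \<beta> \<gamma> n) (X n)"
  shows "\<exists>(\<omega>\<^sub>X :: real) (\<omega>\<^sub>1 :: real) (\<omega>\<^sub>2 :: nat \<Rightarrow> real).
    \<omega>\<^sub>X > 0 \<and> \<omega>\<^sub>1 > 0 \<and> (\<exists>c. converges_geometrically \<omega>\<^sub>2 c) \<and>
    (\<forall>n\<ge>1.
      (\<forall>X1. best_rank1_approx (X n) X1 \<longrightarrow>
         frob_sq (X n - X1) \<ge> frob_sq (X n) - \<omega>\<^sub>X\<^sup>2) \<and>
      (\<forall>B B1. B \<in> carrier_mat n n \<and> reorganization (X n) B \<and> first_col_is_diag (X n) B \<and>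
         best_rank1_approx B B1 \<longrightarrow>
         frob_sq (B - B1) \<le> frob_sq (X n) - \<omega>\<^sub>1 * real n - \<omega>\<^sub>2 n)) \<and>
    strict_mono_on {1..} (\<lambda>n. \<omega>\<^sub>1 * real n + \<omega>\<^sub>2 n) \<and>
    (\<exists>N. \<forall>n\<ge>N. n \<ge> 1 \<longrightarrow>
      (\<forall>X1 B B1. best_rank1_approx (X n) X1 \<and>
         B \<in> carrier_mat n n \<and> reorganization (X n) B \<and> first_col_is_diag (X n) B \<and>
         best_rank1_approx B B1 \<longrightarrow>
         frob_sq (B - B1) < frob_sq (X n - X1)))"
proof -
  define q where "q = \<alpha> * \<beta>"
  define s where "s = 1 / (\<gamma> * (1 - \<bar>\<alpha>\<bar>) * (1 - \<bar>\<beta>\<bar>))"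
  \<comment> \<open>The slope is the square of \<open>1 / (\<gamma> * (1 - q))\<close>, the limit of
    the diagonal values; \<open>\<omega>\<^sub>2\<close> below is what remains of the exact gain
    \<open>a * S n\<close>.\<close>
  define a where "a = 1 / (\<gamma> * (1 - q))\<^sup>2"
  define S where "S n = (\<Sum>k<n. (1 - q ^ Suc k)\<^sup>2)" for n
  define \<omega>\<^sub>2 where "\<omega>\<^sub>2 n = a * (S n - real n)" for n
  have q: "\<bar>q\<bar> < 1"
    using assms(1,2) mult_strict_mono'[of "\<bar>\<alpha>\<bar>" 1 "\<bar>\<beta>\<bar>" 1] by (simp add: q_def abs_mult)
  have s: "s > 0" using assms(1-3) by (simp add: s_def)
  have a: "a > 0" using assms(3) q by (simp add: a_def)
  have aS: "a * real n + \<omega>\<^sub>2 n = a * S n" for n by (simp add: \<omega>\<^sub>2_def algebra_simps)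
  have conv: "\<exists>c. converges_geometrically \<omega>\<^sub>2 c"
    using converges_geometrically_sum_sq[OF q, of a] a unfolding \<omega>\<^sub>2_def S_def by simp
  \<comment> \<open>Keeps the summands of \<open>S\<close> away from 0, which yields both strict
    growth and a linear lower bound.\<close>
  have gap: "1 - \<bar>q\<bar> \<le> 1 - q ^ Suc k" for k
  proof -
    have "q ^ Suc k \<le> \<bar>q\<bar> * \<bar>q\<bar> ^ k" by (metis abs_ge_self power_Suc power_abs)
    also have "\<dots> \<le> \<bar>q\<bar> * 1" using q by (intro mult_left_mono power_le_one) auto
    finally show ?thesis by simp
  qed
  have mono: "strict_mono_on {1..} (\<lambda>n. a * real n + \<omega>\<^sub>2 n)"
  proof -
    have "S n < S (Suc n)" for n
      using gap[of n] q by (simp add: S_def del: power_Suc)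
    then have "strict_mono S" by (simp add: strict_mono_Suc_iff)
    then show ?thesis using a by (simp add: aS strict_mono_on_def strict_mono_def)
  qed
  have lower: "frob_sq (X n - X1) \<ge> frob_sq (X n) - s\<^sup>2"
    if "n \<ge> 1" "best_rank1_approx (X n) X1" for n X1
  proof -
    note Xn = assms(4)[OF that(1)] assms(6)[OF that(1)]
    show ?thesis
    proof (rule frob_sq_minus_rank_le_1[OF Xn(1)])
      show "X1 \<in> carrier_mat n n" "vec_space.rank n X1 \<le> 1"
        using that(2) Xn(1) by (auto simp: best_rank1_approx_def)
      show "(\<Sum>i<n. (\<Sum>j<n. X n $$ (i, j) * v j)\<^sup>2) \<le> s\<^sup>2 * (\<Sum>j<n. (v j)\<^sup>2)" for v
        unfolding s_def by (rule tridiag_inverse_norm_le[OF assms(1-3) Xn])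
    qed
  qed
  have upper: "frob_sq (B - B1) \<le> frob_sq (X n) - a * S n"
    if "n \<ge> 1" "B \<in> carrier_mat n n" "reorganization (X n) B" "first_col_is_diag (X n) B"
      "best_rank1_approx B B1" for n B B1
    using frob_sq_minus_first_col[OF that(2,5)] frob_sq_reorganization[OF that(3)]
      sum_sq_first_col[OF assms(4)[OF that(1)] that(2,4)]
      sum_sq_diag_tridiag_inverse[OF assms(1-3) assms(4)[OF that(1)] assms(6)[OF that(1)]]
    by (simp add: a_def S_def q_def)
  \<comment> \<open>Each diagonal entry contributes at least \<open>d\<close> to the gain, so more
    than \<open>s\<^sup>2 / d\<close> of them outweigh the bounded gain \<open>s\<^sup>2\<close> for
    \<open>X n\<close>.\<close>
  define d where "d = a * (1 - \<bar>q\<bar>)\<^sup>2"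
  have d: "d > 0" using a q by (simp add: d_def)
  obtain N :: nat where N: "s\<^sup>2 / d < real N" using reals_Archimedean2 by blast
  have large: "s\<^sup>2 < a * S n" if "n \<ge> N" for n
  proof -
    have "s\<^sup>2 < real N * d" using N d by (simp add: field_simps)
    also have "\<dots> \<le> real n * d" using that d by simp
    also have "\<dots> = a * (\<Sum>k<n. (1 - \<bar>q\<bar>)\<^sup>2)" by (simp add: d_def)
    also have "\<dots> \<le> a * S n"
      unfolding S_def using a q by (intro mult_left_mono sum_mono power_mono gap) auto
    finally show ?thesis .
  qed
  show ?thesis
  proof (rule exI[of _ s], rule exI[of _ a], rule exI[of _ \<omega>\<^sub>2], intro conjI allI impI)
    show "frob_sq (B - B1) \<le> frob_sq (X n) - a * real n - \<omega>\<^sub>2 n"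
      if "n \<ge> 1" "B \<in> carrier_mat n n \<and> reorganization (X n) B \<and> first_col_is_diag (X n) B \<and>
         best_rank1_approx B B1" for n B B1
      using upper[of n B B1] that aS[of n] by auto
    show "\<exists>N. \<forall>n\<ge>N. n \<ge> 1 \<longrightarrow>
      (\<forall>X1 B B1. best_rank1_approx (X n) X1 \<and>
         B \<in> carrier_mat n n \<and> reorganization (X n) B \<and> first_col_is_diag (X n) B \<and>
         best_rank1_approx B B1 \<longrightarrow>
         frob_sq (B - B1) < frob_sq (X n - X1))"
    proof (intro exI[of _ N] allI impI, elim conjE)
      fix n X1 B B1
      assume n: "N \<le> n" "1 \<le> n" and X1: "best_rank1_approx (X n) X1"
        and B: "B \<in> carrier_mat n n" "reorganization (X n) B" "first_col_is_diag (X n) B"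
          "best_rank1_approx B B1"
      show "frob_sq (B - B1) < frob_sq (X n - X1)"
        using lower[OF n(2) X1] upper[OF n(2) B] large[OF n(1)] by linarith
    qed
  qed (use s a conv mono lower in auto)
qed

end
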